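(* Let $n\ge1$. Number the $2n+1$ external nodes of a ternary tree with $n$ internal nodes by $0,1,\dots,2n$ from left to right (inorder traversal). For $m_1,m_2,m_3\ge0$ let $T_{n,s,m_1,m_2,m_3}$ be the number of ternary trees of size $n$ in which the path from the root to external node $s$ consists of $m_1$ left edges, $m_2$ center edges and $m_3$ right edges. Write $s=2s_1+s_2$ with $0\le s_1\le n$, $s_2\in\{0,1\}$. Then: (i) if $0\le m_3\le s_1$, $m_2=s_2+2\mu_2$ with $0\le\mu_2\le s_1-m_3$, and $(m_1,m_2)\ne(0,0)$, $(m_3,m_2)\ne(0,0)$, $$T_{n,s,m_1,m_2,m_3}=\frac{(2m_3+m_2)(2m_1+m_2)\binom{m_1+m_2+m_3}{m_1,m_2,m_3}\binom{3s_1+s_2-m_3-\mu_2}{s_1-m_3-\mu_2}\binom{3n-m_1-2m_2-3s_1+3\mu_2}{n-m_1-m_2-s_1+\mu_2}}{(3s_1+s_2-m_3-\mu_2)(3n-m_1-2m_2-3s_1+3\mu_2)};$$ (ii) if $(m_2,m_3)=(0,0)$, $s=0$ and $0\le m_1\le n$, then $T_{n,s,m_1,m_2,m_3}=\frac{2m_1}{3n-m_1}\binom{3n-m_1}{2n}$; (iii) if $(m_1,m_2)=(0,0)$, $s=2n$ and $0\le m_3\le n$, then $T_{n,s,m_1,m_2,m_3}=\frac{2m_3}{3n-m_3}\binom{3n-m_3}{2n}$; (iv) in all other cases $T_{n,s,m_1,m_2,m_3}=0$.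
   Context: A ternary tree is either an external node or an internal node with three ordered subtrees (left, center, right); size = number of internal nodes, so a tree of size $n$ has $2n+1$ external nodes. Inorder traversal: starting at the root, recursively traverse the left, then the center, then the right subtree; external nodes are numbered $0,1,2,\dots$ in the order visited. An edge from a node to its left (center, right) child is called a left (center, right) edge (types $e_1,e_2,e_3$). *)

theory Defs
  imports Complex_Main
begin

datatype ttree = External | Internal ttree ttree ttree

primrec internal_nodes :: "ttree \<Rightarrow> nat" where
  "internal_nodes External = 0"
| "internal_nodes (Internal l c r) = 1 + internal_nodes l + internal_nodes c + internal_nodes r"

datatype edge = LeftE | CenterE | RightE

text \<open>
  The paths from the root to the external nodes, in inorder. Entry \<open>s\<close> of the list is the path
  to external node number \<open>s\<close>, counting from 0.
\<close>

primrec external_paths :: "ttree \<Rightarrow> edge list list" where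
  "external_paths External = [[]]"
| "external_paths (Internal l c r) =
     map ((#) LeftE) (external_paths l) @
     map ((#) CenterE) (external_paths c) @
     map ((#) RightE) (external_paths r)"

lemma length_external_paths: "length (external_paths t) = 2 * internal_nodes t + 1"
  by (induction t) auto

lemma finite_ttrees: "finite {t. internal_nodes t = n}"
proof -
  have "finite {t. internal_nodes t \<le> n}"
  proof (induction n)
    case 0
    have "{t. internal_nodes t \<le> 0} \<subseteq> {External}"
    proof
      fix t assume "t \<in> {t. internal_nodes t \<le> 0}"
      then show "t \<in> {External}" by (cases t) auto
    qed
    then show ?case by (rule finite_subset) simp
  next
    case (Suc n)
    let ?A = "{t. internal_nodes t \<le> n}"
    have "{t. internal_nodes t \<le> Suc n}
            \<subseteq> insert External ((\<lambda>(l, c, r). Internal l c r) ` (?A \<times> ?A \<times> ?A))"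
    proof
      fix t assume "t \<in> {t. internal_nodes t \<le> Suc n}"
      then show "t \<in> insert External ((\<lambda>(l, c, r). Internal l c r) ` (?A \<times> ?A \<times> ?A))"
        by (cases t) (auto simp: image_iff)
    qed
    then show ?case by (rule finite_subset) (use Suc in auto)
  qed
  then show ?thesis by (rule rev_finite_subset) auto
qed

definition num_ttrees :: "nat \<Rightarrow> nat \<Rightarrow> nat \<Rightarrow> nat \<Rightarrow> nat \<Rightarrow> nat" where
  "num_ttrees n s m\<^sub>1 m\<^sub>2 m\<^sub>3 =
     card {t. internal_nodes t = n \<and> s < length (external_paths t) \<and>
              count_list (external_paths t ! s) LeftE = m\<^sub>1 \<and>
              count_list (external_paths t ! s) CenterE = m\<^sub>2 \<and>
              count_list (external_paths t ! s) RightE = m\<^sub>3}"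

definition trinomial :: "nat \<Rightarrow> nat \<Rightarrow> nat \<Rightarrow> real" where
  "trinomial a b c = fact (a + b + c) / (fact a * fact b * fact c)"

text \<open>
  Binomial coefficient with integer arguments, equal to 0 for a negative lower argument. In the
  formula for \<open>num_ttrees\<close> the lower argument is negative when \<open>m\<^sub>1\<close> is large; a denominator can
  vanish only in that case, where the quotient is 0 since \<open>x / 0 = 0\<close>.
\<close>

definition ibinom :: "int \<Rightarrow> int \<Rightarrow> real" where
  "ibinom a k = (if k < 0 then 0 else real_of_int a gchoose nat k)"

end

theory Submission
  imports Defs "HOL-Combinatorics.Multiset_Permutations"
begin

text \<open>
  Fix the word \<open>w\<close> of edge types on the path. Every left edge leaves two subtrees to the right of the
  path, every right edge two to its left, and every center edge one on each side. So a tree with path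
  \<open>w\<close> is a pair of ordered forests, one of \<open>2m\<^sub>3 + m\<^sub>2\<close> trees on the left and one of \<open>2m\<^sub>1 + m\<^sub>2\<close> trees
  on the right. A forest of \<open>k\<close> trees with \<open>L\<close> internal nodes has \<open>2L + k\<close> external nodes, hence \<open>s\<close>
  determines the number of internal nodes on each side, independently of the order of the letters
  of \<open>w\<close>. The trinomial coefficient counts the words, and the number of forests of \<open>k\<close> trees with
  \<open>n\<close> internal nodes is \<open>k / (3n + k)\<close> times \<open>3n + k\<close> choose \<open>n\<close>, by removing the root of the first
  tree.
\<close>

section \<open>Counting ordered forests of ternary trees\<close>

definition forest_nodes :: "ttree list \<Rightarrow> nat" where
  "forest_nodes ts = sum_list (map internal_nodes ts)"

lemma forest_nodes_simps [simp]:
  "forest_nodes [] = 0"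
  "forest_nodes (t # ts) = internal_nodes t + forest_nodes ts"
  by (simp_all add: forest_nodes_def)

definition forests :: "nat \<Rightarrow> nat \<Rightarrow> ttree list set" where
  "forests k n = {ts. length ts = k \<and> forest_nodes ts = n}"

lemma internal_nodes_eq_0_iff [simp]: "internal_nodes t = 0 \<longleftrightarrow> t = External"
  by (cases t) auto

lemma forests_0: "forests 0 n = (if n = 0 then {[]} else {})"
  by (auto simp: forests_def)

lemma forests_no_nodes: "forests k 0 = {replicate k External}"
proof -
  have "forest_nodes ts = 0 \<longleftrightarrow> ts = replicate (length ts) External" for ts
    by (induction ts) auto
  then have "ts \<in> forests k 0 \<longleftrightarrow> ts = replicate k External" for ts
    unfolding forests_def using length_replicate by (metis (mono_tags) mem_Collect_eq)
  then show ?thesis by blast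
qed

lemma finite_forests: "finite (forests k n)"
proof (rule finite_subset)
  have "set ts \<subseteq> (\<Union>m\<le>forest_nodes ts. {t. internal_nodes t = m})" for ts
    by (induction ts) force+
  then show "forests k n \<subseteq> {ts. set ts \<subseteq> (\<Union>m\<le>n. {t. internal_nodes t = m}) \<and> length ts = k}"
    by (auto simp: forests_def)
  show "finite \<dots>"
    by (simp add: finite_ttrees finite_lists_length_eq)
qed

lemma card_forests_Suc_Suc:
  "card (forests (Suc k) (Suc n)) = card (forests k (Suc n)) + card (forests (k + 3) n)"
proof -
  \<comment> \<open>\<open>?plant\<close> undoes the removal of the root. The default
    \<open>[]\<close> never occurs on lists of at least three trees.\<close>
  let ?plant = "\<lambda>ts. case ts of l # c # r # us \<Rightarrow> Internal l c r # us | _ \<Rightarrow> []"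
  have split: "forests (Suc k) (Suc n) =
      (#) External ` forests k (Suc n) \<union> ?plant ` forests (k + 3) n"
  proof (intro equalityI subsetI)
    fix ts assume "ts \<in> forests (Suc k) (Suc n)"
    then obtain t us where ts: "ts = t # us" "length us = k"
      "internal_nodes t + forest_nodes us = Suc n"
      by (auto simp: forests_def length_Suc_conv)
    show "ts \<in> (#) External ` forests k (Suc n) \<union> ?plant ` forests (k + 3) n"
    proof (cases t)
      case External
      with ts show ?thesis by (auto simp: forests_def)
    next
      case (Internal l c r)
      with ts have "l # c # r # us \<in> forests (k + 3) n" "ts = ?plant (l # c # r # us)"
        by (auto simp: forests_def)
      then show ?thesis by blast
    qed
  qed (auto simp: forests_def numeral_3_eq_3 length_Suc_conv)
  have "inj_on ?plant (forests (k + 3) n)"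
  proof (rule inj_on_inverseI)
    show "(case ?plant ts of Internal l c r # us \<Rightarrow> l # c # r # us) = ts" if "ts \<in> forests (k + 3) n" for ts
      using that by (auto simp: forests_def numeral_3_eq_3 length_Suc_conv)
  qed
  moreover have "(#) External ` forests k (Suc n) \<inter> ?plant ` forests (k + 3) n = {}"
    by (auto simp: forests_def numeral_3_eq_3 length_Suc_conv)
  ultimately show ?thesis
    unfolding split by (subst card_Un_disjoint) (auto simp: finite_forests card_image)
qed

text \<open>Stated without division so that it also holds for the empty forest. The recurrence
  lowers \<open>k\<close>, or lowers \<open>n\<close> while raising \<open>k\<close>; hence an inner
  induction on \<open>k\<close> inside an outer one on \<open>n\<close> for all
  \<open>k\<close>.\<close>

lemma card_forests_times:
  "real (3 * n + k) * real (card (forests k n)) = real k * real ((3 * n + k) choose n)"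
proof (induction n arbitrary: k)
  case 0
  then show ?case by (simp add: forests_no_nodes)
next
  case (Suc n)
  note outer_IH = Suc.IH
  show ?case
  proof (induction k)
    case 0
    then show ?case by (simp add: forests_0)
  next
    case (Suc k)
    \<comment> \<open>Both smaller instances have upper binomial index \<open>M\<close>, the goal
      has \<open>Suc M\<close>.\<close>
    define M where "M = 3 * n + k + 3"
    define x where "x = real (M choose n)"
    have absorb: "real (Suc n) * real (Suc M choose Suc n) = real (Suc M) * x"
      unfolding x_def using Suc_times_binomial_eq[of M n] by (metis mult.commute of_nat_mult)
    have "real (Suc M choose Suc n) = x + real (M choose Suc n)"
      by (simp add: x_def)
    with absorb have next_coeff: "real (Suc n) * real (M choose Suc n) = (real M - real n) * x"
      by (simp add: algebra_simps)
    have IH1: "real M * real (card (forests (k + 3) n)) = real (k + 3) * x"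
      using outer_IH[of "k + 3"]
      by (simp add: M_def x_def add.assoc)
    have IH2: "real M * real (card (forests k (Suc n))) = real k * real (M choose Suc n)"
      using Suc.IH by (simp add: M_def algebra_simps)
    have "real (Suc n) * real M * real (card (forests (Suc k) (Suc n)))
        = real k * (real (Suc n) * real (M choose Suc n)) + real (Suc n) * (real M * real (card (forests (k + 3) n)))"
      unfolding card_forests_Suc_Suc using IH2 by (simp add: algebra_simps)
    \<comment> \<open>In \<open>k * (M - n) + (k + 3) * (n + 1)\<close> the terms
      \<open>k * n\<close> cancel and the rest of the second product, \<open>3 * n + k + 3\<close>,
      is \<open>M\<close> again.\<close>
    also have "\<dots> = real (k + 1) * real M * x"
      unfolding next_coeff IH1 by (simp add: M_def algebra_simps)
    finally have "real (Suc n) * real (card (forests (Suc k) (Suc n))) = real (Suc k) * x"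
      by (simp add: M_def)
    then have "real (Suc n) * (real (Suc M) * real (card (forests (Suc k) (Suc n))))
        = real (Suc n) * (real (Suc k) * real (Suc M choose Suc n))"
      using absorb by (metis (no_types, opaque_lifting) mult.left_commute)
    then have "real (Suc M) * real (card (forests (Suc k) (Suc n))) = real (Suc k) * real (Suc M choose Suc n)"
      by (simp del: of_nat_Suc binomial_Suc_Suc)
    moreover have "3 * Suc n + Suc k = Suc M" by (simp add: M_def)
    ultimately show ?case by metis
  qed
qed

text \<open>The premise excludes the quotient 0 / 0, whose value 0 differs from the count 1 of the
  empty forest.\<close>

lemma card_forests:
  assumes "k > 0 \<or> n > 0"
  shows "real (card (forests k n)) = real k * real ((3 * n + k) choose n) / real (3 * n + k)"
proof -
  have "real (3 * n + k) \<noteq> 0" using assms by linarith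
  then show ?thesis
    using card_forests_times[of n k] by (metis mult.commute nonzero_eq_divide_eq)
qed

text \<open>Serves the straight paths of \<open>m\<close> left or \<open>m\<close> right edges,
  where all other nodes lie in a single forest of \<open>2 * m\<close> trees. Symmetry of the
  binomial coefficient turns the lower index \<open>n - m\<close> into \<open>2 * n\<close>.\<close>

lemma card_forests_even:
  assumes "m \<le> n" and "n > 0"
  shows "real (card (forests (2 * m) (n - m))) =
    2 * real m / (3 * real n - real m) * real ((3 * n - m) choose (2 * n))"
proof -
  have top: "3 * (n - m) + 2 * m = 3 * n - m"
    using assms by simp
  have "(3 * n - m) choose (n - m) = (3 * n - m) choose (2 * n)"
    using binomial_symmetric[of "2 * n" "3 * n - m"] assms by (simp add: diff_diff_left)
  moreover have "real (3 * n - m) = 3 * real n - real m"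
    using assms by (simp add: of_nat_diff)
  moreover have "2 * m > 0 \<or> n - m > 0"
    using assms by linarith
  ultimately show ?thesis
    using card_forests[of "2 * m" "n - m"] unfolding top by simp
qed

section \<open>Trees with a given path as pairs of forests\<close>

definition leaf_at :: "ttree \<Rightarrow> nat \<Rightarrow> edge list \<Rightarrow> bool" where
  "leaf_at t i w \<longleftrightarrow> i < length (external_paths t) \<and> external_paths t ! i = w"

lemma leaf_at_External [simp]: "leaf_at External i w \<longleftrightarrow> i = 0 \<and> w = []"
  by (auto simp: leaf_at_def)

lemma nth_append_eq_iff:
  "i < length (xs @ ys) \<and> (xs @ ys) ! i = z \<longleftrightarrow>
     i < length xs \<and> xs ! i = z \<or> (\<exists>j. i = length xs + j \<and> j < length ys \<and> ys ! j = z)"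
proof (cases "i < length xs")
  case False
  then obtain j where "i = length xs + j"
    using le_Suc_ex not_less by blast
  then show ?thesis by simp
qed (simp add: nth_append)

lemma nth_map_Cons_eq_iff:
  "i < length (map ((#) e) ps) \<and> map ((#) e) ps ! i = w \<longleftrightarrow>
     i < length ps \<and> w = e # ps ! i"
  by auto

text \<open>Passing a sibling subtree with \<open>k\<close> internal nodes skips its
  \<open>2 * k + 1\<close> external nodes. The existential offsets avoid truncated
  subtraction.\<close>

lemma leaf_at_Internal [simp]:
  "\<not> leaf_at (Internal l c r) i []"
  "leaf_at (Internal l c r) i (LeftE # w) \<longleftrightarrow> leaf_at l i w"
  "leaf_at (Internal l c r) i (CenterE # w) \<longleftrightarrow>
     (\<exists>j. i = 2 * internal_nodes l + 1 + j \<and> leaf_at c j w)"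
  "leaf_at (Internal l c r) i (RightE # w) \<longleftrightarrow>
     (\<exists>j. i = 2 * internal_nodes l + 1 + (2 * internal_nodes c + 1 + j) \<and> leaf_at r j w)"
proof -
  have split: "leaf_at (Internal l c r) i v \<longleftrightarrow>
      i < length (external_paths l) \<and> v = LeftE # external_paths l ! i \<or>
      (\<exists>j. i = 2 * internal_nodes l + 1 + j \<and>
        (j < length (external_paths c) \<and> v = CenterE # external_paths c ! j \<or>
        (\<exists>k. j = 2 * internal_nodes c + 1 + k \<and>
          k < length (external_paths r) \<and> v = RightE # external_paths r ! k)))" for v
    unfolding leaf_at_def external_paths.simps nth_append_eq_iff nth_map_Cons_eq_iff
    unfolding length_map length_external_paths by (rule refl)
  show "\<not> leaf_at (Internal l c r) i []"
    unfolding split by blast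
  show "leaf_at (Internal l c r) i (LeftE # w) \<longleftrightarrow> leaf_at l i w"
    unfolding split unfolding leaf_at_def by blast
  show "leaf_at (Internal l c r) i (CenterE # w) \<longleftrightarrow>
     (\<exists>j. i = 2 * internal_nodes l + 1 + j \<and> leaf_at c j w)"
    unfolding split unfolding leaf_at_def by blast
  show "leaf_at (Internal l c r) i (RightE # w) \<longleftrightarrow>
     (\<exists>j. i = 2 * internal_nodes l + 1 + (2 * internal_nodes c + 1 + j) \<and> leaf_at r j w)"
    unfolding split unfolding leaf_at_def by blast
qed

text \<open>
  The subtrees hanging off the path spelled by \<open>w\<close> are collected on the left and on the right
  while walking down; \<open>d\<close> counts the path nodes already passed.
\<close>

definition spine :: "edge list \<Rightarrow> nat \<Rightarrow> nat \<Rightarrow> nat \<Rightarrow> nat \<Rightarrow> nat \<Rightarrow> (ttree list \<times> ttree \<times> ttree list) set"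
  where
  "spine w a b d n s = {(ls, t, rs). length ls = a \<and> length rs = b \<and>
     forest_nodes ls + internal_nodes t + forest_nodes rs + d = n \<and>
     (\<exists>i. leaf_at t i w \<and> 2 * forest_nodes ls + a + i = s)}"

lemma card_spine_Nil:
  "card (spine [] a b d n s) = card {(ls, rs). length ls = a \<and> length rs = b \<and>
     forest_nodes ls + forest_nodes rs + d = n \<and> 2 * forest_nodes ls + a = s}" (is "_ = card ?P")
proof -
  have "leaf_at t i [] \<longleftrightarrow> t = External \<and> i = 0" for t i
    by (cases t) auto
  then have "spine [] a b d n s = (\<lambda>(ls, rs). (ls, External, rs)) ` ?P"
    by (auto simp: spine_def image_iff)
  then show ?thesis
    by (auto intro!: card_image inj_onI)
qed

text \<open>One step down: the root joins the path and its two other subtrees move to the lists. A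
  subtree moved left adds to \<open>2 * forest_nodes ls + a\<close> exactly the external nodes
  skipped, so \<open>s\<close> stays fixed.\<close>

lemma card_spine_Cons:
  "card (spine (LeftE # w) a b d n s) = card (spine w a (b + 2) (d + 1) n s)"
  "card (spine (CenterE # w) a b d n s) = card (spine w (a + 1) (b + 1) (d + 1) n s)"
  "card (spine (RightE # w) a b d n s) = card (spine w (a + 2) b (d + 1) n s)"
proof -
  show "card (spine (LeftE # w) a b d n s) = card (spine w a (b + 2) (d + 1) n s)"
    \<comment> \<open>\<open>f\<close> takes the root apart and \<open>f'\<close> rebuilds it from
      the heads of the lists. The middle tree is never \<open>External\<close>, since a nonempty
      word must still be followed.\<close>
    by (rule bij_betw_same_card[OF bij_betw_byWitness[where
          f = "\<lambda>(ls, t, rs). case t of Internal l c r \<Rightarrow> (ls, l, c # r # rs)" and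
          f' = "\<lambda>(ls, t, rs). case rs of c # r # us \<Rightarrow> (ls, Internal t c r, us)"]])
      (auto simp: spine_def length_Suc_conv split: ttree.splits)
  show "card (spine (CenterE # w) a b d n s) = card (spine w (a + 1) (b + 1) (d + 1) n s)"
    by (rule bij_betw_same_card[OF bij_betw_byWitness[where
          f = "\<lambda>(ls, t, rs). case t of Internal l c r \<Rightarrow> (l # ls, c, r # rs)" and
          f' = "\<lambda>(ls, t, rs). case (ls, rs) of (l # us, r # vs) \<Rightarrow> (us, Internal l t r, vs)"]])
      (auto simp: spine_def length_Suc_conv split: ttree.splits)
  show "card (spine (RightE # w) a b d n s) = card (spine w (a + 2) b (d + 1) n s)"
    by (rule bij_betw_same_card[OF bij_betw_byWitness[where
          f = "\<lambda>(ls, t, rs). case t of Internal l c r \<Rightarrow> (l # c # ls, r, rs)" and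
          f' = "\<lambda>(ls, t, rs). case ls of l # c # us \<Rightarrow> (us, Internal l c t, rs)"]])
      (auto simp: spine_def length_Suc_conv split: ttree.splits)
qed

definition forest_pairs :: "nat \<Rightarrow> nat \<Rightarrow> nat \<Rightarrow> nat \<Rightarrow> nat \<Rightarrow> (ttree list \<times> ttree list) set" where
  "forest_pairs a b d n s = {(ls, rs). length ls = a \<and> length rs = b \<and>
     forest_nodes ls + forest_nodes rs + d = n \<and> 2 * forest_nodes ls + a = s}"

text \<open>The letters contribute additively to the list lengths and to the depth, so their order
  drops out.\<close>

lemma card_spine:
  "card (spine w a b d n s) =
     card (forest_pairs (a + count_list w CenterE + 2 * count_list w RightE)
       (b + count_list w CenterE + 2 * count_list w LeftE) (d + length w) n s)"
proof (induction w arbitrary: a b d)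
  case Nil
  then show ?case by (simp add: card_spine_Nil forest_pairs_def)
next
  case (Cons e w)
  then show ?case by (cases e) (simp_all add: card_spine_Cons)
qed

text \<open>At the root nothing has been collected, so \<open>spine w 0 0 0 n s\<close> is a copy of
  the set of trees.\<close>

lemma card_trees_with_leaf:
  "card {t. internal_nodes t = n \<and> leaf_at t s w} =
     card (forest_pairs (count_list w CenterE + 2 * count_list w RightE)
       (count_list w CenterE + 2 * count_list w LeftE) (length w) n s)"
proof -
  have "spine w 0 0 0 n s = (\<lambda>t. ([], t, [])) ` {t. internal_nodes t = n \<and> leaf_at t s w}"
    by (auto simp: spine_def)
  then have "card (spine w 0 0 0 n s) = card {t. internal_nodes t = n \<and> leaf_at t s w}"
    by (simp add: card_image inj_on_def)
  then show ?thesis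
    by (simp add: card_spine)
qed

section \<open>Counting words with given letter counts\<close>

definition words :: "nat \<Rightarrow> nat \<Rightarrow> nat \<Rightarrow> edge list set" where
  "words m\<^sub>1 m\<^sub>2 m\<^sub>3 =
     {w. count_list w LeftE = m\<^sub>1 \<and> count_list w CenterE = m\<^sub>2 \<and> count_list w RightE = m\<^sub>3}"

lemma words_eq_permutations:
  "words m\<^sub>1 m\<^sub>2 m\<^sub>3 = permutations_of_multiset
     (replicate_mset m\<^sub>1 LeftE + replicate_mset m\<^sub>2 CenterE + replicate_mset m\<^sub>3 RightE)"
proof -
  have "(\<forall>e. P e) \<longleftrightarrow> P LeftE \<and> P CenterE \<and> P RightE" for P
    by (metis edge.exhaust)
  then show ?thesis
    by (simp add: permutations_of_multiset_def words_def multiset_eq_iff count_mset)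
qed

lemma finite_words: "finite (words m\<^sub>1 m\<^sub>2 m\<^sub>3)"
  by (simp add: words_eq_permutations)

lemma card_words: "real (card (words m\<^sub>1 m\<^sub>2 m\<^sub>3)) = trinomial m\<^sub>1 m\<^sub>2 m\<^sub>3"
proof -
  let ?M = "replicate_mset m\<^sub>1 LeftE + replicate_mset m\<^sub>2 CenterE + replicate_mset m\<^sub>3 RightE"
  \<comment> \<open>Absent letters contribute \<open>fact 0 = 1\<close>, so the product may run over
    all three letters.\<close>
  have "(\<Prod>e\<in>set_mset ?M. fact (count ?M e) :: nat) =
      (\<Prod>e\<in>{LeftE, CenterE, RightE}. fact (count ?M e))"
    by (rule prod.mono_neutral_left) (auto simp: count_eq_zero_iff intro: edge.exhaust)
  also have "\<dots> = fact m\<^sub>1 * fact m\<^sub>2 * fact m\<^sub>3"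
    by simp
  finally have "card (words m\<^sub>1 m\<^sub>2 m\<^sub>3) * (fact m\<^sub>1 * fact m\<^sub>2 * fact m\<^sub>3) = fact (m\<^sub>1 + m\<^sub>2 + m\<^sub>3)"
    using card_permutations_of_multiset_aux[of ?M] by (simp add: words_eq_permutations)
  then have "real (card (words m\<^sub>1 m\<^sub>2 m\<^sub>3)) * (fact m\<^sub>1 * fact m\<^sub>2 * fact m\<^sub>3) = fact (m\<^sub>1 + m\<^sub>2 + m\<^sub>3)"
    by (metis of_nat_fact of_nat_mult)
  then show ?thesis
    by (simp add: trinomial_def field_simps)
qed

lemma length_words:
  "w \<in> words m\<^sub>1 m\<^sub>2 m\<^sub>3 \<Longrightarrow> length w = m\<^sub>1 + m\<^sub>2 + m\<^sub>3"
  by (simp add: words_eq_permutations length_finite_permutations_of_multiset)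

section \<open>The number of trees as a product\<close>

text \<open>External node \<open>s\<close> has only one path, so different words give disjoint sets
  of trees, all of the same size.\<close>

lemma num_ttrees_eq:
  "num_ttrees n s m\<^sub>1 m\<^sub>2 m\<^sub>3 = card (words m\<^sub>1 m\<^sub>2 m\<^sub>3) *
     card (forest_pairs (m\<^sub>2 + 2 * m\<^sub>3) (m\<^sub>2 + 2 * m\<^sub>1) (m\<^sub>1 + m\<^sub>2 + m\<^sub>3) n s)"
proof -
  let ?T = "\<lambda>w. {t. internal_nodes t = n \<and> leaf_at t s w}"
  have "num_ttrees n s m\<^sub>1 m\<^sub>2 m\<^sub>3 = card (\<Union>w\<in>words m\<^sub>1 m\<^sub>2 m\<^sub>3. ?T w)"
    unfolding num_ttrees_def by (rule arg_cong[where f = card]) (auto simp: leaf_at_def words_def)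
  also have "\<dots> = (\<Sum>w\<in>words m\<^sub>1 m\<^sub>2 m\<^sub>3. card (?T w))"
    by (rule card_UN_disjoint)
      (auto simp: finite_words leaf_at_def intro: finite_subset[OF _ finite_ttrees[of n]])
  also have "\<dots> = (\<Sum>w\<in>words m\<^sub>1 m\<^sub>2 m\<^sub>3.
      card (forest_pairs (m\<^sub>2 + 2 * m\<^sub>3) (m\<^sub>2 + 2 * m\<^sub>1) (m\<^sub>1 + m\<^sub>2 + m\<^sub>3) n s))"
    by (rule sum.cong) (auto simp: card_trees_with_leaf length_words, simp add: words_def)
  finally show ?thesis by simp
qed

text \<open>\<open>L\<close> and \<open>R\<close> are the node counts of the two forests. A forest
  pair would supply values for which both factors are nonzero.\<close>

lemma num_ttrees_eq_0:
  assumes "\<And>L R. m\<^sub>2 + 2 * m\<^sub>3 + 2 * L = s \<Longrightarrow> L + R + m\<^sub>1 + m\<^sub>2 + m\<^sub>3 = n \<Longrightarrow>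
    card (forests (m\<^sub>2 + 2 * m\<^sub>3) L) * card (forests (m\<^sub>2 + 2 * m\<^sub>1) R) = 0"
  shows "num_ttrees n s m\<^sub>1 m\<^sub>2 m\<^sub>3 = 0"
proof -
  have "forests (length ls) (forest_nodes ls) \<noteq> {}" for ls
    by (auto simp: forests_def)
  then have nonzero: "card (forests (length ls) (forest_nodes ls)) \<noteq> 0" for ls
    by (simp add: finite_forests)
  have "(ls, rs) \<notin> forest_pairs (m\<^sub>2 + 2 * m\<^sub>3) (m\<^sub>2 + 2 * m\<^sub>1) (m\<^sub>1 + m\<^sub>2 + m\<^sub>3) n s" for ls rs
    using assms[of "forest_nodes ls" "forest_nodes rs"] nonzero[of ls] nonzero[of rs]
    by (auto simp: forest_pairs_def)
  then have "forest_pairs (m\<^sub>2 + 2 * m\<^sub>3) (m\<^sub>2 + 2 * m\<^sub>1) (m\<^sub>1 + m\<^sub>2 + m\<^sub>3) n s = {}"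
    by auto
  then show ?thesis
    by (simp add: num_ttrees_eq)
qed

text \<open>The position \<open>s\<close> forces \<open>L\<close>, then the size forces
  \<open>R\<close>, so the two forests can be chosen independently.\<close>

lemma num_ttrees_product:
  assumes "m\<^sub>2 + 2 * m\<^sub>3 + 2 * L = s" and "L + R + m\<^sub>1 + m\<^sub>2 + m\<^sub>3 = n"
  shows "real (num_ttrees n s m\<^sub>1 m\<^sub>2 m\<^sub>3) = trinomial m\<^sub>1 m\<^sub>2 m\<^sub>3 *
    real (card (forests (2 * m\<^sub>3 + m\<^sub>2) L)) * real (card (forests (2 * m\<^sub>1 + m\<^sub>2) R))"
proof -
  have "forest_pairs (m\<^sub>2 + 2 * m\<^sub>3) (m\<^sub>2 + 2 * m\<^sub>1) (m\<^sub>1 + m\<^sub>2 + m\<^sub>3) n s =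
      forests (2 * m\<^sub>3 + m\<^sub>2) L \<times> forests (2 * m\<^sub>1 + m\<^sub>2) R"
    using assms by (auto simp: forest_pairs_def forests_def)
  then show ?thesis
    by (simp add: num_ttrees_eq card_words card_cartesian_product)
qed

lemma ibinom_nat: "ibinom (int a) (int k) = real (a choose k)"
  by (simp add: ibinom_def binomial_gbinomial)

section \<open>The four cases of the formula\<close>

theorem theorem4:
  fixes n s s\<^sub>1 s\<^sub>2 m\<^sub>1 m\<^sub>2 m\<^sub>3 :: nat
  assumes "n \<ge> 1"
    and "s \<le> 2 * n"
    and "s = 2 * s\<^sub>1 + s\<^sub>2" and "s\<^sub>1 \<le> n" and "s\<^sub>2 \<in> {0, 1}"
  shows
    "(\<forall>\<mu>\<^sub>2::nat.
        m\<^sub>3 \<le> s\<^sub>1 \<and> m\<^sub>2 = s\<^sub>2 + 2 * \<mu>\<^sub>2 \<and> \<mu>\<^sub>2 \<le> s\<^sub>1 - m\<^sub>3 \<and> (m\<^sub>1, m\<^sub>2) \<noteq> (0, 0) \<and> (m\<^sub>3, m\<^sub>2) \<noteq> (0, 0) \<longrightarrow>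
        real (num_ttrees n s m\<^sub>1 m\<^sub>2 m\<^sub>3) =
          (2 * real m\<^sub>3 + real m\<^sub>2) * (2 * real m\<^sub>1 + real m\<^sub>2) * trinomial m\<^sub>1 m\<^sub>2 m\<^sub>3
          * ibinom (3 * int s\<^sub>1 + int s\<^sub>2 - int m\<^sub>3 - int \<mu>\<^sub>2) (int s\<^sub>1 - int m\<^sub>3 - int \<mu>\<^sub>2)
          * ibinom (3 * int n - int m\<^sub>1 - 2 * int m\<^sub>2 - 3 * int s\<^sub>1 + 3 * int \<mu>\<^sub>2)
                   (int n - int m\<^sub>1 - int m\<^sub>2 - int s\<^sub>1 + int \<mu>\<^sub>2)
          / ((3 * real s\<^sub>1 + real s\<^sub>2 - real m\<^sub>3 - real \<mu>\<^sub>2)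
             * (3 * real n - real m\<^sub>1 - 2 * real m\<^sub>2 - 3 * real s\<^sub>1 + 3 * real \<mu>\<^sub>2)))
   \<and> ((m\<^sub>2, m\<^sub>3) = (0, 0) \<and> s = 0 \<and> m\<^sub>1 \<le> n \<longrightarrow>
        real (num_ttrees n s m\<^sub>1 m\<^sub>2 m\<^sub>3) =
          2 * real m\<^sub>1 / (3 * real n - real m\<^sub>1) * real ((3 * n - m\<^sub>1) choose (2 * n)))
   \<and> ((m\<^sub>1, m\<^sub>2) = (0, 0) \<and> s = 2 * n \<and> m\<^sub>3 \<le> n \<longrightarrow>
        real (num_ttrees n s m\<^sub>1 m\<^sub>2 m\<^sub>3) =
          2 * real m\<^sub>3 / (3 * real n - real m\<^sub>3) * real ((3 * n - m\<^sub>3) choose (2 * n)))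
   \<and> (\<not> (\<exists>\<mu>\<^sub>2::nat.
          m\<^sub>3 \<le> s\<^sub>1 \<and> m\<^sub>2 = s\<^sub>2 + 2 * \<mu>\<^sub>2 \<and> \<mu>\<^sub>2 \<le> s\<^sub>1 - m\<^sub>3 \<and> (m\<^sub>1, m\<^sub>2) \<noteq> (0, 0) \<and> (m\<^sub>3, m\<^sub>2) \<noteq> (0, 0))
      \<and> \<not> ((m\<^sub>2, m\<^sub>3) = (0, 0) \<and> s = 0 \<and> m\<^sub>1 \<le> n)
      \<and> \<not> ((m\<^sub>1, m\<^sub>2) = (0, 0) \<and> s = 2 * n \<and> m\<^sub>3 \<le> n) \<longrightarrow>
        num_ttrees n s m\<^sub>1 m\<^sub>2 m\<^sub>3 = 0)"
proof (intro conjI allI impI)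
  fix \<mu> :: nat
  assume asm: "m\<^sub>3 \<le> s\<^sub>1 \<and> m\<^sub>2 = s\<^sub>2 + 2 * \<mu> \<and> \<mu> \<le> s\<^sub>1 - m\<^sub>3 \<and> (m\<^sub>1, m\<^sub>2) \<noteq> (0, 0) \<and> (m\<^sub>3, m\<^sub>2) \<noteq> (0, 0)"
  \<comment> \<open>\<open>A\<close> and \<open>B\<close> are the numbers of trees on the left and
    right; \<open>L\<close> solves \<open>2 * L + A = s\<close>. The two inequations on pairs say
    that neither forest is empty.\<close>
  define A B L where "A = 2 * m\<^sub>3 + m\<^sub>2" and "B = 2 * m\<^sub>1 + m\<^sub>2" and "L = s\<^sub>1 - m\<^sub>3 - \<mu>"
  have pos: "A > 0" "B > 0" using asm by (auto simp: A_def B_def)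
  have s\<^sub>1: "s\<^sub>1 = L + m\<^sub>3 + \<mu>" and m\<^sub>2: "m\<^sub>2 = s\<^sub>2 + 2 * \<mu>"
    using asm by (auto simp: L_def)
  have s: "m\<^sub>2 + 2 * m\<^sub>3 + 2 * L = s"
    using s\<^sub>1 m\<^sub>2 assms by simp
  let ?rhs = "(2 * real m\<^sub>3 + real m\<^sub>2) * (2 * real m\<^sub>1 + real m\<^sub>2) * trinomial m\<^sub>1 m\<^sub>2 m\<^sub>3
          * ibinom (3 * int s\<^sub>1 + int s\<^sub>2 - int m\<^sub>3 - int \<mu>) (int s\<^sub>1 - int m\<^sub>3 - int \<mu>)
          * ibinom (3 * int n - int m\<^sub>1 - 2 * int m\<^sub>2 - 3 * int s\<^sub>1 + 3 * int \<mu>)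
                   (int n - int m\<^sub>1 - int m\<^sub>2 - int s\<^sub>1 + int \<mu>)
          / ((3 * real s\<^sub>1 + real s\<^sub>2 - real m\<^sub>3 - real \<mu>)
             * (3 * real n - real m\<^sub>1 - 2 * real m\<^sub>2 - 3 * real s\<^sub>1 + 3 * real \<mu>))"
  show "real (num_ttrees n s m\<^sub>1 m\<^sub>2 m\<^sub>3) = ?rhs"
  \<comment> \<open>Does the size leave room for the path and the left forest? If not, no tree
    exists and the second \<open>ibinom\<close> has a negative lower argument.\<close>
  proof (cases "L + m\<^sub>1 + m\<^sub>2 + m\<^sub>3 \<le> n")
    case True
    define R where "R = n - (L + m\<^sub>1 + m\<^sub>2 + m\<^sub>3)"
    have n: "L + R + m\<^sub>1 + m\<^sub>2 + m\<^sub>3 = n" using True by (simp add: R_def)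
    have ints: "3 * int s\<^sub>1 + int s\<^sub>2 - int m\<^sub>3 - int \<mu> = int (3 * L + A)"
      "int s\<^sub>1 - int m\<^sub>3 - int \<mu> = int L"
      "3 * int n - int m\<^sub>1 - 2 * int m\<^sub>2 - 3 * int s\<^sub>1 + 3 * int \<mu> = int (3 * R + B)"
      "int n - int m\<^sub>1 - int m\<^sub>2 - int s\<^sub>1 + int \<mu> = int R"
      unfolding n[symmetric] s\<^sub>1 A_def B_def m\<^sub>2 by simp_all
    have reals: "3 * real s\<^sub>1 + real s\<^sub>2 - real m\<^sub>3 - real \<mu> = real (3 * L + A)"
      "3 * real n - real m\<^sub>1 - 2 * real m\<^sub>2 - 3 * real s\<^sub>1 + 3 * real \<mu> = real (3 * R + B)"
      "2 * real m\<^sub>3 + real m\<^sub>2 = real A" "2 * real m\<^sub>1 + real m\<^sub>2 = real B"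
      unfolding n[symmetric] s\<^sub>1 A_def B_def m\<^sub>2 by simp_all
    have "real (num_ttrees n s m\<^sub>1 m\<^sub>2 m\<^sub>3) = trinomial m\<^sub>1 m\<^sub>2 m\<^sub>3 *
        (real A * real ((3 * L + A) choose L) / real (3 * L + A)) *
        (real B * real ((3 * R + B) choose R) / real (3 * R + B))"
      using num_ttrees_product[OF s n] pos card_forests[of A L] card_forests[of B R]
      unfolding A_def[symmetric] B_def[symmetric] by metis
    also have "\<dots> = ?rhs"
      unfolding ints reals ibinom_nat by (simp add: mult_ac)
    finally show ?thesis .
  next
    case False
    then have "int n - int m\<^sub>1 - int m\<^sub>2 - int s\<^sub>1 + int \<mu> < 0"
      by (simp add: s\<^sub>1)
    then have "?rhs = 0" by (simp add: ibinom_def)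
    moreover have "num_ttrees n s m\<^sub>1 m\<^sub>2 m\<^sub>3 = 0"
      by (rule num_ttrees_eq_0) (use False s in simp)
    ultimately show ?thesis by (simp only: of_nat_0)
  qed
next
  assume asm: "(m\<^sub>2, m\<^sub>3) = (0, 0) \<and> s = 0 \<and> m\<^sub>1 \<le> n"
  \<comment> \<open>A path of left edges only: a single word, and an empty forest on the
    left.\<close>
  have "real (num_ttrees n s m\<^sub>1 m\<^sub>2 m\<^sub>3) = trinomial m\<^sub>1 0 0 *
      real (card (forests 0 0)) * real (card (forests (2 * m\<^sub>1) (n - m\<^sub>1)))"
    using num_ttrees_product[of m\<^sub>2 m\<^sub>3 0 s "n - m\<^sub>1" m\<^sub>1 n] asm by simp
  then show "real (num_ttrees n s m\<^sub>1 m\<^sub>2 m\<^sub>3) =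
      2 * real m\<^sub>1 / (3 * real n - real m\<^sub>1) * real ((3 * n - m\<^sub>1) choose (2 * n))"
    using card_forests_even[of m\<^sub>1 n] asm assms(1) by (simp add: trinomial_def forests_0)
next
  assume asm: "(m\<^sub>1, m\<^sub>2) = (0, 0) \<and> s = 2 * n \<and> m\<^sub>3 \<le> n"
  \<comment> \<open>The mirror image, with \<open>L = n - m\<^sub>3\<close> and
    \<open>R = 0\<close>.\<close>
  have position: "m\<^sub>2 + 2 * m\<^sub>3 + 2 * (n - m\<^sub>3) = s" and nodes: "(n - m\<^sub>3) + 0 + m\<^sub>1 + m\<^sub>2 + m\<^sub>3 = n"
    using asm by auto
  have "real (num_ttrees n s m\<^sub>1 m\<^sub>2 m\<^sub>3) = trinomial 0 0 m\<^sub>3 *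
      real (card (forests (2 * m\<^sub>3) (n - m\<^sub>3))) * real (card (forests 0 0))"
    using num_ttrees_product[OF position nodes] asm by simp
  then show "real (num_ttrees n s m\<^sub>1 m\<^sub>2 m\<^sub>3) =
      2 * real m\<^sub>3 / (3 * real n - real m\<^sub>3) * real ((3 * n - m\<^sub>3) choose (2 * n))"
    using card_forests_even[of m\<^sub>3 n] asm assms(1) by (simp add: trinomial_def forests_0)
next
  assume asm: "\<not> (\<exists>\<mu>\<^sub>2::nat.
          m\<^sub>3 \<le> s\<^sub>1 \<and> m\<^sub>2 = s\<^sub>2 + 2 * \<mu>\<^sub>2 \<and> \<mu>\<^sub>2 \<le> s\<^sub>1 - m\<^sub>3 \<and> (m\<^sub>1, m\<^sub>2) \<noteq> (0, 0) \<and> (m\<^sub>3, m\<^sub>2) \<noteq> (0, 0))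
      \<and> \<not> ((m\<^sub>2, m\<^sub>3) = (0, 0) \<and> s = 0 \<and> m\<^sub>1 \<le> n)
      \<and> \<not> ((m\<^sub>1, m\<^sub>2) = (0, 0) \<and> s = 2 * n \<and> m\<^sub>3 \<le> n)"
  note no_generic = asm[THEN conjunct1]
    and no_left = asm[THEN conjunct2, THEN conjunct1]
    and no_right = asm[THEN conjunct2, THEN conjunct2]
  show "num_ttrees n s m\<^sub>1 m\<^sub>2 m\<^sub>3 = 0"
  proof (rule num_ttrees_eq_0)
    fix L R assume LR: "m\<^sub>2 + 2 * m\<^sub>3 + 2 * L = s" "L + R + m\<^sub>1 + m\<^sub>2 + m\<^sub>3 = n"
    obtain \<mu> where \<mu>: "m\<^sub>2 = s\<^sub>2 + 2 * \<mu>"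
    proof
      \<comment> \<open>By the position equation \<open>m\<^sub>2\<close> has the parity of
        \<open>s\<close>, which is \<open>s\<^sub>2\<close>.\<close>
      show "m\<^sub>2 = s\<^sub>2 + 2 * (m\<^sub>2 div 2)"
        using LR(1) assms(3,5) by simp presburger
    qed
    then have "m\<^sub>3 \<le> s\<^sub>1" "\<mu> \<le> s\<^sub>1 - m\<^sub>3"
      using LR(1) assms(3) by auto
    \<comment> \<open>All bounds of case (i) hold, so it can only fail because one side has no
      trees.\<close>
    with \<mu> no_generic have "(m\<^sub>1, m\<^sub>2) = (0, 0) \<or> (m\<^sub>3, m\<^sub>2) = (0, 0)"
      by metis
    then show "card (forests (m\<^sub>2 + 2 * m\<^sub>3) L) * card (forests (m\<^sub>2 + 2 * m\<^sub>1) R) = 0"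
    proof
      assume "(m\<^sub>1, m\<^sub>2) = (0, 0)"
      \<comment> \<open>\<open>R = 0\<close> would give \<open>s = 2 * n\<close>, which is case
        (iii); and a forest without trees cannot have nodes.\<close>
      with no_right LR have "R \<noteq> 0" by auto
      with \<open>(m\<^sub>1, m\<^sub>2) = (0, 0)\<close> show ?thesis by (simp add: forests_0)
    next
      assume "(m\<^sub>3, m\<^sub>2) = (0, 0)"
      \<comment> \<open>Likewise \<open>L = 0\<close> would give \<open>s = 0\<close>, which is case
        (ii).\<close>
      with no_left LR have "L \<noteq> 0" by auto
      with \<open>(m\<^sub>3, m\<^sub>2) = (0, 0)\<close> show ?thesis by (simp add: forests_0)
    qed
  qed
qed

end
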